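(* Let $X$ be a nonempty set equipped with a separated uniformity $\mathscr U$ generated by a nonempty family $\mathscr F$ of pseudometrics with associated collection $\mathscr V$ of basic entourages, and let $G$ be a directed graph with $V(G)=X$ and $E(G)\supseteq\Delta(X)$. Let $X$ be sequentially complete and let $T:X\to X$ be an orbitally $G$-continuous Banach $G$-contraction. Let $\mathrm{Fix}(T)$ be its set of fixed points and $X_T=\{x\in X:(x,Tx)\in E(G)\}$. Then: 1. If $x\in X_T$, then there exists a unique $x^*\in\mathrm{Fix}(T)$ such that $T^ny\to x^*$ for all $y\in[x]_{\widetilde G}$. In particular, if $x^*\in[x]_{\widetilde G}$, then $T|_{[x]_{\widetilde G}}$ is a Picard operator. 2. If $X_T$ is nonempty and $G$ is weakly connected, then $T$ is a Picard operator. 3. $T$ has a fixed point in $X$ if and only if $X_T$ is nonempty. 4. $T|_{X'}$ is a weakly Picard operator, where $X'=\bigcup\{[x]_{\widetilde G}:x\in X_T\}$. 5. If $X_T=X$, then $T$ is a weakly Picard operator.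
   Context: Uniform structure: $\mathscr U$ is a uniformity on $X$; separated means $\bigcap\mathscr U=\Delta(X)=\{(x,x):x\in X\}$. Convergence is in the uniform topology; $X$ is sequentially complete if every Cauchy sequence converges. $\mathscr F$ is a nonempty family of (uniformly continuous) pseudometrics on $X$ generating $\mathscr U$. For a pseudometric $\rho$ and $r>0$ put $V(\rho,r)=\{(x,y)\in X\times X:\rho(x,y)<r\}$. $\mathscr V$ is the collection of all sets $\bigcap_{i=1}^m V(\rho_i,r_i)$ with $m\ge1$, $\rho_i\in\mathscr F$, $r_i>0$; it is a base of $\mathscr U$ and its members are called basic entourages. For $V=\bigcap_{i=1}^mV(\rho_i,r_i)\in\mathscr V$ and $\alpha>0$, put $\alpha V=\bigcap_{i=1}^mV(\rho_i,\alpha r_i)$ (a basic entourage is regarded as given together with such a presentation, and $\alpha V$ is formed from it). Graphs: $G$ has vertex set $X$ and edge set $E(G)\subseteq X\times X$ (directed, no parallel edges) containing all loops. $\widetilde G$ has vertex set $X$ and $E(\widetilde G)=\{(x,y):(x,y)\in E(G)\text{ or }(y,x)\in E(G)\}$. $[x]_{\widetilde G}$ is the set of all $y\in X$ joined to $x$ by a path in $\widetilde G$, i.e. a finite sequence $x_0=x,\dots,x_N=y$ with $(x_{i-1},x_i)\in E(\widetilde G)$ for $i=1,\dots,N$. $G$ is weakly connected if $[x]_{\widetilde G}=X$ for all $x\in X$. A mapping $T:X\to X$ is a Banach $G$-contraction if (B1) $(x,y)\in E(G)$ implies $(Tx,Ty)\in E(G)$ for all $x,y\in X$; and (B2) there is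 $\alpha\in(0,1)$ such that $(x,y)\in V\cap E(G)$ implies $(Tx,Ty)\in\alpha V$ for all $x,y\in X$ and all $V\in\mathscr V$. $T$ is orbitally $G$-continuous on $X$ if for all $x,y\in X$ and every sequence $\{p_n\}$ of positive integers with $(T^{p_n}x,T^{p_{n+1}}x)\in E(G)$ for $n=1,2,\ldots$, $T^{p_n}x\to y$ implies $T(T^{p_n}x)\to Ty$ as $n\to\infty$. $T$ is a Picard operator if it has a unique fixed point $x^*$ and $T^nx\to x^*$ for all $x$ in its domain; it is a weakly Picard operator if for every $x$ in its domain $\{T^nx\}$ converges to a fixed point of $T$. For $A\subseteq X$, saying that $T|_A$ is a Picard operator means that $T(A)\subseteq A$ and that $T|_A:A\to A$ is a Picard operator (with fixed point in $A$). Saying that $T|_{X'}$ is a weakly Picard operator means that $T(X')\subseteq X'$ and that for every $x\in X'$ the sequence $\{T^nx\}$ converges to a fixed point of $T$ (vacuous if $X'=\emptyset$). *)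

theory Defs
  imports Complex_Main
begin

text \<open>
  The set \<open>X\<close> is the universe of a type \<open>'a\<close> of class \<^class>\<open>uniform_space\<close>: its uniformity
  is the filter \<^const>\<open>uniformity\<close> on pairs, and limits and Cauchy sequences are taken in it.
\<close>

definition separated_uniformity :: "'a::uniform_space itself \<Rightarrow> bool" where
  "separated_uniformity _ \<longleftrightarrow>
     \<Inter> {U :: ('a \<times> 'a) set. eventually (\<lambda>p. p \<in> U) uniformity} = Id"

definition sequentially_complete :: "'a::uniform_space itself \<Rightarrow> bool" where
  "sequentially_complete _ \<longleftrightarrow> (\<forall>s :: nat \<Rightarrow> 'a. Cauchy s \<longrightarrow> convergent s)"

definition pseudometric :: "('a \<Rightarrow> 'a \<Rightarrow> real) \<Rightarrow> bool" where
  "pseudometric \<rho> \<longleftrightarrow>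
     (\<forall>x y. 0 \<le> \<rho> x y) \<and> (\<forall>x. \<rho> x x = 0) \<and> (\<forall>x y. \<rho> x y = \<rho> y x) \<and>
     (\<forall>x y z. \<rho> x z \<le> \<rho> x y + \<rho> y z)"

definition pm_entourage :: "('a \<Rightarrow> 'a \<Rightarrow> real) \<Rightarrow> real \<Rightarrow> ('a \<times> 'a) set" where
  "pm_entourage \<rho> r = {(x, y). \<rho> x y < r}"

text \<open>
  The set \<open>\<alpha>V\<close> depends on how \<open>V\<close> is written as an intersection, so a basic entourage is
  represented by a presentation: the nonempty list of the pairs \<open>(\<rho>\<^sub>i, r\<^sub>i)\<close>.
\<close>

type_synonym 'a presentation = "(('a \<Rightarrow> 'a \<Rightarrow> real) \<times> real) list"

definition presentations :: "('a \<Rightarrow> 'a \<Rightarrow> real) set \<Rightarrow> 'a presentation set" where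
  "presentations F = {v. v \<noteq> [] \<and> set v \<subseteq> F \<times> {0<..}}"

definition entourage_of :: "'a presentation \<Rightarrow> ('a \<times> 'a) set" where
  "entourage_of v = (\<Inter>(\<rho>, r)\<in>set v. pm_entourage \<rho> r)"

definition scale :: "real \<Rightarrow> 'a presentation \<Rightarrow> 'a presentation" where
  "scale \<alpha> v = map (\<lambda>(\<rho>, r). (\<rho>, \<alpha> * r)) v"

definition basic_entourages :: "('a \<Rightarrow> 'a \<Rightarrow> real) set \<Rightarrow> ('a \<times> 'a) set set" where
  "basic_entourages F = entourage_of ` presentations F"

text \<open>
  \<open>F\<close> generates the uniformity if the basic entourages form a base of it; in particular every
  member of \<open>F\<close> is then uniformly continuous.
\<close>

definition generates_uniformity :: "('a::uniform_space \<Rightarrow> 'a \<Rightarrow> real) set \<Rightarrow> bool" where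
  "generates_uniformity F \<longleftrightarrow>
     (\<forall>U. eventually (\<lambda>p. p \<in> U) uniformity \<longleftrightarrow> (\<exists>V\<in>basic_entourages F. V \<subseteq> U))"

text \<open>A directed graph on \<open>X\<close> without parallel edges is given by its edge set \<open>E\<close>.\<close>

definition undirected :: "('a \<times> 'a) set \<Rightarrow> ('a \<times> 'a) set" where
  "undirected E = {(x, y). (x, y) \<in> E \<or> (y, x) \<in> E}"

definition component :: "('a \<times> 'a) set \<Rightarrow> 'a \<Rightarrow> 'a set" where
  "component E x =
     {y. \<exists>(N::nat) p. p 0 = x \<and> p N = y \<and> (\<forall>i\<in>{1..N}. (p (i - 1), p i) \<in> undirected E)}"

lemma component_eq_rtrancl: "component E x = {y. (x, y) \<in> (undirected E)\<^sup>*}"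
proof -
  have "(\<forall>i\<in>{1..N}. (p (i - 1), p i) \<in> undirected E) \<longleftrightarrow>
        (\<forall>i<N. (p i, p (Suc i)) \<in> undirected E)" for N :: nat and p :: "nat \<Rightarrow> 'a"
    by (force simp: Suc_le_eq gr0_conv_Suc)
  then show ?thesis
    by (simp add: component_def rtrancl_power relpow_fun_conv)
qed

definition weakly_connected :: "('a \<times> 'a) set \<Rightarrow> bool" where
  "weakly_connected E \<longleftrightarrow> (\<forall>x. component E x = UNIV)"

definition Banach_G_contraction ::
    "('a \<Rightarrow> 'a \<Rightarrow> real) set \<Rightarrow> ('a \<times> 'a) set \<Rightarrow> ('a \<Rightarrow> 'a) \<Rightarrow> bool" where
  "Banach_G_contraction F E T \<longleftrightarrow>
     (\<forall>x y. (x, y) \<in> E \<longrightarrow> (T x, T y) \<in> E) \<and>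
     (\<exists>\<alpha>. 0 < \<alpha> \<and> \<alpha> < 1 \<and>
        (\<forall>x y. \<forall>v\<in>presentations F.
           (x, y) \<in> entourage_of v \<inter> E \<longrightarrow> (T x, T y) \<in> entourage_of (scale \<alpha> v)))"

definition orbitally_G_continuous ::
    "('a \<times> 'a) set \<Rightarrow> ('a::uniform_space \<Rightarrow> 'a) \<Rightarrow> bool" where
  "orbitally_G_continuous E T \<longleftrightarrow>
     (\<forall>x y. \<forall>p :: nat \<Rightarrow> nat.
        (\<forall>n. 0 < p n) \<and> (\<forall>n. ((T ^^ p n) x, (T ^^ p (Suc n)) x) \<in> E) \<and>
        (\<lambda>n. (T ^^ p n) x) \<longlonglongrightarrow> y \<longrightarrow>
        (\<lambda>n. T ((T ^^ p n) x)) \<longlonglongrightarrow> T y)"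

definition Fix :: "('a \<Rightarrow> 'a) \<Rightarrow> 'a set" where
  "Fix T = {x. T x = x}"

definition Picard_operator_on :: "'a::uniform_space set \<Rightarrow> ('a \<Rightarrow> 'a) \<Rightarrow> bool" where
  "Picard_operator_on A T \<longleftrightarrow>
     T ` A \<subseteq> A \<and>
     (\<exists>z\<in>A. T z = z \<and> (\<forall>w\<in>A. T w = w \<longrightarrow> w = z) \<and> (\<forall>x\<in>A. (\<lambda>n. (T ^^ n) x) \<longlonglongrightarrow> z))"

definition weakly_Picard_operator_on :: "'a::uniform_space set \<Rightarrow> ('a \<Rightarrow> 'a) \<Rightarrow> bool" where
  "weakly_Picard_operator_on A T \<longleftrightarrow>
     T ` A \<subseteq> A \<and> (\<forall>x\<in>A. \<exists>z\<in>Fix T. (\<lambda>n. (T ^^ n) x) \<longlonglongrightarrow> z)"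

definition edge_start_set :: "('a \<times> 'a) set \<Rightarrow> ('a \<Rightarrow> 'a) \<Rightarrow> 'a set" where
  "edge_start_set E T = {x. (x, T x) \<in> E}"

end

theory Submission
  imports Defs
begin

text \<open>
  Applying the contraction condition to the entourages \<open>V(\<rho>, r)\<close> with \<open>r\<close> decreasing to
  \<open>\<rho>(x, y)\<close> gives \<open>\<rho>(Tx, Ty) \<le> \<alpha> \<rho>(x, y)\<close> along every edge, for each
  \<open>\<rho> \<in> F\<close>, and by symmetry of \<open>\<rho>\<close> along the edges of the undirected graph. Hence the orbit
  of a point \<open>x\<close> with \<open>(x, Tx) \<in> E\<close> is Cauchy by a geometric series, and the orbits of
  points joined by a path are asymptotic. Orbital continuity along the whole orbit shows that its limit
  is fixed.
\<close>

section \<open>Limits, Cauchy sequences and separation through the generating pseudometrics\<close>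

lemma tendsto_zero_dominated:
  fixes f g :: "'b \<Rightarrow> real"
  assumes "(g \<longlongrightarrow> 0) A" and "\<And>b. 0 \<le> f b" and "\<And>b. f b \<le> g b"
  shows "(f \<longlongrightarrow> 0) A"
  by (rule tendsto_sandwich[OF _ _ tendsto_const assms(1)]) (simp_all add: assms)

locale generating_family =
  fixes F :: "('a::uniform_space \<Rightarrow> 'a \<Rightarrow> real) set"
  assumes pseudometrics: "\<And>\<rho>. \<rho> \<in> F \<Longrightarrow> pseudometric \<rho>"
    and generates: "generates_uniformity F"
begin

lemma pm_nonneg: "\<rho> \<in> F \<Longrightarrow> 0 \<le> \<rho> x y"
  and pm_refl: "\<rho> \<in> F \<Longrightarrow> \<rho> x x = 0"
  and pm_sym: "\<rho> \<in> F \<Longrightarrow> \<rho> x y = \<rho> y x"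
  and pm_triangle: "\<rho> \<in> F \<Longrightarrow> \<rho> x z \<le> \<rho> x y + \<rho> y z"
  using pseudometrics unfolding pseudometric_def by blast+

lemma eventually_uniformity_iff:
  "eventually P uniformity \<longleftrightarrow> (\<exists>v\<in>presentations F. entourage_of v \<subseteq> Collect P)"
  using generates[unfolded generates_uniformity_def, rule_format, of "Collect P"]
  by (auto simp: basic_entourages_def)

text \<open>Reduces the uniformity to real limits. Each V(\<rho>, e) is itself a basic entourage;
  conversely, a basic entourage imposes finitely many conditions, and finitely many eventual
  conditions hold eventually together.\<close>

lemma filterlim_uniformity_iff:
  "filterlim g uniformity A \<longleftrightarrow> (\<forall>\<rho>\<in>F. ((\<lambda>b. \<rho> (fst (g b)) (snd (g b))) \<longlongrightarrow> 0) A)"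
proof (intro iffI ballI)
  fix \<rho> assume lim: "filterlim g uniformity A" and \<rho>: "\<rho> \<in> F"
  show "((\<lambda>b. \<rho> (fst (g b)) (snd (g b))) \<longlongrightarrow> 0) A"
  proof (rule tendstoI)
    fix e :: real assume "0 < e"
    then have "eventually (\<lambda>p. \<rho> (fst p) (snd p) < e) uniformity"
      using \<rho> unfolding eventually_uniformity_iff
      by (intro bexI[of _ "[(\<rho>, e)]"]) (auto simp: presentations_def entourage_of_def pm_entourage_def)
    from eventually_compose_filterlim[OF this lim]
    show "\<forall>\<^sub>F b in A. dist (\<rho> (fst (g b)) (snd (g b))) 0 < e"
      using \<rho> by (simp add: dist_real_def pm_nonneg)
  qed
next
  assume lim: "\<forall>\<rho>\<in>F. ((\<lambda>b. \<rho> (fst (g b)) (snd (g b))) \<longlongrightarrow> 0) A"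
  show "filterlim g uniformity A"
    unfolding filterlim_iff
  proof (intro allI impI)
    fix P assume "eventually P (uniformity :: ('a \<times> 'a) filter)"
    then obtain v where v: "v \<in> presentations F" "entourage_of v \<subseteq> Collect P"
      by (auto simp: eventually_uniformity_iff)
    have "\<forall>\<^sub>F b in A. \<rho> (fst (g b)) (snd (g b)) < r" if "(\<rho>, r) \<in> set v" for \<rho> r
      using that v(1) lim by (intro order_tendstoD(2)[of _ 0]) (auto simp: presentations_def)
    then have "\<forall>\<^sub>F b in A. \<forall>q\<in>set v. fst q (fst (g b)) (snd (g b)) < snd q"
      by (intro eventually_ball_finite) auto
    then show "\<forall>\<^sub>F b in A. P (g b)"
      by eventually_elim
        (use v(2) in \<open>force simp: entourage_of_def pm_entourage_def split_beta\<close>)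
  qed
qed

lemma tendsto_iff_pseudometrics:
  "(f \<longlongrightarrow> z) A \<longleftrightarrow> (\<forall>\<rho>\<in>F. ((\<lambda>b. \<rho> (f b) z) \<longlongrightarrow> 0) A)"
proof -
  have "(f \<longlongrightarrow> z) A \<longleftrightarrow> filterlim (\<lambda>b. (z, f b)) uniformity A"
  proof
    assume lim: "(f \<longlongrightarrow> z) A"
    show "filterlim (\<lambda>b. (z, f b)) uniformity A"
      unfolding filterlim_iff
    proof (intro allI impI)
      fix P assume "eventually P (uniformity :: ('a \<times> 'a) filter)"
      then have "\<forall>\<^sub>F y in nhds z. P (z, y)"
        by (auto simp: eventually_nhds_uniformity elim!: eventually_mono)
      then show "\<forall>\<^sub>F b in A. P (z, f b)"
        using lim by (rule eventually_compose_filterlim)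
    qed
  next
    assume lim: "filterlim (\<lambda>b. (z, f b)) uniformity A"
    show "(f \<longlongrightarrow> z) A"
      unfolding filterlim_iff
    proof (intro allI impI)
      fix P assume "eventually P (nhds z)"
      \<comment> \<open>The implication turns a neighbourhood property of \<open>z\<close> into an
        entourage: only pairs starting at \<open>z\<close> are constrained.\<close>
      then have "eventually (\<lambda>(z', y). z' = z \<longrightarrow> P y) uniformity"
        by (simp add: eventually_nhds_uniformity)
      from eventually_compose_filterlim[OF this lim]
      show "\<forall>\<^sub>F b in A. P (f b)" by simp
    qed
  qed
  then show ?thesis
    by (simp add: filterlim_uniformity_iff pm_sym[of _ z])
qed

text \<open>The bound is asked only for \<open>m \<le> n\<close> and may depend on \<open>m\<close>
  alone, which is the shape of a geometric tail estimate.\<close>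

lemma Cauchy_pseudometrics:
  assumes "\<And>\<rho>. \<rho> \<in> F \<Longrightarrow> \<exists>C. C \<longlonglongrightarrow> 0 \<and> (\<forall>m n. m \<le> n \<longrightarrow> \<rho> (s m) (s n) \<le> C m)"
  shows "Cauchy s"
proof -
  \<comment> \<open>The components are swapped to agree with the variable order in
    \<open>eventually_prod_sequentially\<close>.\<close>
  have "((\<lambda>b. \<rho> (s (snd b)) (s (fst b))) \<longlongrightarrow> 0) (sequentially \<times>\<^sub>F sequentially)"
    if \<rho>: "\<rho> \<in> F" for \<rho>
  proof -
    obtain C where C: "C \<longlonglongrightarrow> 0" "\<And>m n. m \<le> n \<Longrightarrow> \<rho> (s m) (s n) \<le> C m"
      using assms[OF \<rho>] by blast
    \<comment> \<open>A symmetric bound covers both orders of the indices; the absolute values make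
      the extra summand harmless.\<close>
    have "\<rho> (s n) (s m) \<le> \<bar>C m\<bar> + \<bar>C n\<bar>" for m n
      using C(2)[of m n] C(2)[of n m] pm_sym[OF \<rho>, of "s m" "s n"] by (cases "m \<le> n") auto
    moreover have "((\<lambda>b. \<bar>C (fst b)\<bar> + \<bar>C (snd b)\<bar>) \<longlongrightarrow> 0) (sequentially \<times>\<^sub>F sequentially)"
      by (intro tendsto_add_zero tendsto_rabs_zero filterlim_compose[OF C(1)])
        (simp_all add: filterlim_def filtermap_fst_prod_filter filtermap_snd_prod_filter)
    ultimately show ?thesis
      by (intro tendsto_zero_dominated[OF _ pm_nonneg[OF \<rho>]])
  qed
  then have "filterlim (\<lambda>b. (s (snd b), s (fst b))) uniformity (sequentially \<times>\<^sub>F sequentially)"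
    by (simp add: filterlim_uniformity_iff)
  then show ?thesis
    by (simp add: Cauchy_uniform_iff filterlim_iff eventually_prod_sequentially)
qed

text \<open>Since all radii are positive, a pair at distance 0 for every pseudometric lies in every
  basic entourage, hence in the intersection of all entourages.\<close>

lemma separatedD:
  assumes "separated_uniformity TYPE('a)" and "\<And>\<rho>. \<rho> \<in> F \<Longrightarrow> \<rho> x y = 0"
  shows "x = y"
proof -
  have "(x, y) \<in> U" if U: "eventually (\<lambda>p. p \<in> U) uniformity" for U
  proof -
    obtain v where v: "v \<in> presentations F" "entourage_of v \<subseteq> U"
      using U by (auto simp: eventually_uniformity_iff)
    have "(x, y) \<in> entourage_of v"
      using v(1) assms(2) by (fastforce simp: entourage_of_def pm_entourage_def presentations_def)
    with v(2) show ?thesis by blast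
  qed
  then have "(x, y) \<in> Id"
    using assms(1) unfolding separated_uniformity_def by blast
  then show ?thesis by simp
qed

text \<open>The type class \<open>uniform_space\<close> is not Hausdorff, so \<open>LIMSEQ_unique\<close> does not apply.\<close>

lemma tendsto_unique_separated:
  fixes x y :: 'a
  assumes sep: "separated_uniformity TYPE('a)" and "A \<noteq> bot" "(f \<longlongrightarrow> x) A" "(f \<longlongrightarrow> y) A"
  shows "x = y"
proof (rule separatedD[OF sep])
  fix \<rho> assume \<rho>: "\<rho> \<in> F"
  then have "((\<lambda>b. \<rho> (f b) x + \<rho> (f b) y) \<longlongrightarrow> 0) A"
    using assms by (intro tendsto_add_zero) (auto simp: tendsto_iff_pseudometrics)
  moreover have "\<rho> x y \<le> \<rho> (f b) x + \<rho> (f b) y" for b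
    using pm_triangle[OF \<rho>, of x y "f b"] pm_sym[OF \<rho>, of x "f b"] by simp
  ultimately have "\<rho> x y \<le> 0"
    using \<open>A \<noteq> bot\<close> by (intro tendsto_lowerbound) auto
  with pm_nonneg[OF \<rho>] show "\<rho> x y = 0" by (simp add: order_antisym)
qed

end

section \<open>Contraction along edges and the behaviour of orbits\<close>

locale G_contraction = generating_family F
  for F :: "('a::uniform_space \<Rightarrow> 'a \<Rightarrow> real) set" +
  fixes E :: "('a \<times> 'a) set" and T :: "'a \<Rightarrow> 'a"
  assumes contraction: "Banach_G_contraction F E T"
begin

lemma edge_map: "(x, y) \<in> E \<Longrightarrow> (T x, T y) \<in> E"
  using contraction by (auto simp: Banach_G_contraction_def)

lemma undirected_funpow:
  "(x, y) \<in> undirected E \<Longrightarrow> ((T ^^ n) x, (T ^^ n) y) \<in> undirected E"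
  by (induction n) (auto simp: undirected_def edge_map)

text \<open>Kept in \<open>E\<close> rather than \<open>undirected E\<close>, because orbital
  continuity asks for directed edges between successive terms.\<close>

lemma orbit_edge: "x \<in> edge_start_set E T \<Longrightarrow> ((T ^^ n) x, (T ^^ Suc n) x) \<in> E"
  by (induction n) (auto simp: edge_start_set_def edge_map)

lemma contraction_undirected:
  obtains \<alpha> where "0 < \<alpha>" "\<alpha> < 1"
    "\<And>\<rho> x y n. \<rho> \<in> F \<Longrightarrow> (x, y) \<in> undirected E \<Longrightarrow> \<rho> ((T ^^ n) x) ((T ^^ n) y) \<le> \<alpha> ^ n * \<rho> x y"
proof -
  obtain \<alpha> where \<alpha>: "0 < \<alpha>" "\<alpha> < 1"
    and contr: "\<And>x y v. v \<in> presentations F \<Longrightarrow> (x, y) \<in> entourage_of v \<inter> E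
      \<Longrightarrow> (T x, T y) \<in> entourage_of (scale \<alpha> v)"
    using contraction unfolding Banach_G_contraction_def by blast
  have edge: "\<rho> (T x) (T y) \<le> \<alpha> * \<rho> x y" if \<rho>: "\<rho> \<in> F" and xy: "(x, y) \<in> E" for \<rho> x y
  proof (rule dense_ge)
    fix t assume "\<alpha> * \<rho> x y < t"
    then have r: "\<rho> x y < t / \<alpha>" using \<alpha> by (simp add: field_simps)
    \<comment> \<open>The radius \<open>t / \<alpha>\<close> is chosen so that scaling by
      \<open>\<alpha>\<close> yields V(\<rho>, t). It exceeds \<rho>(x, y), hence is positive even
      when that distance is 0.\<close>
    with pm_nonneg[OF \<rho>, of x y] have "[(\<rho>, t / \<alpha>)] \<in> presentations F"
      using \<rho> by (simp add: presentations_def del: zero_less_divide_iff)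
    from contr[OF this, of x y] r xy \<alpha> show "\<rho> (T x) (T y) \<le> t"
      by (simp add: entourage_of_def pm_entourage_def scale_def)
  qed
  have step: "\<rho> (T x) (T y) \<le> \<alpha> * \<rho> x y" if "\<rho> \<in> F" "(x, y) \<in> undirected E" for \<rho> x y
    using that edge[of \<rho> x y] edge[of \<rho> y x] pm_sym[of \<rho>] by (auto simp: undirected_def)
  have "\<rho> ((T ^^ n) x) ((T ^^ n) y) \<le> \<alpha> ^ n * \<rho> x y"
    if "\<rho> \<in> F" "(x, y) \<in> undirected E" for \<rho> x y n
  proof (induction n)
    case (Suc n)
    have "\<rho> ((T ^^ Suc n) x) ((T ^^ Suc n) y) \<le> \<alpha> * \<rho> ((T ^^ n) x) ((T ^^ n) y)"
      using step that undirected_funpow by simp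
    also have "\<dots> \<le> \<alpha> * (\<alpha> ^ n * \<rho> x y)"
      using Suc \<alpha> by (intro mult_left_mono) auto
    finally show ?case by (simp add: mult.assoc)
  qed simp
  with \<alpha> show ?thesis by (rule that)
qed

text \<open>Induction along the path: by the triangle inequality each further edge adds only an
  error \<open>\<alpha> ^ n * \<rho> y z\<close>, which vanishes in the limit.\<close>

lemma orbits_asymptotic:
  assumes "(x, y) \<in> (undirected E)\<^sup>*" and \<rho>: "\<rho> \<in> F"
  shows "(\<lambda>n. \<rho> ((T ^^ n) x) ((T ^^ n) y)) \<longlonglongrightarrow> 0"
  using assms(1)
proof induction
  case base
  show ?case by (simp add: pm_refl[OF \<rho>])
next
  case (step y z)
  obtain \<alpha> where \<alpha>: "0 < \<alpha>" "\<alpha> < 1"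
    and le: "\<And>n. \<rho> ((T ^^ n) y) ((T ^^ n) z) \<le> \<alpha> ^ n * \<rho> y z"
    using contraction_undirected step.hyps(2) \<rho> by metis
  have "(\<lambda>n. \<rho> ((T ^^ n) x) ((T ^^ n) y) + \<alpha> ^ n * \<rho> y z) \<longlonglongrightarrow> 0"
    using \<alpha> by (intro tendsto_add_zero step.IH tendsto_mult_left_zero LIMSEQ_realpow_zero) auto
  moreover have "\<rho> ((T ^^ n) x) ((T ^^ n) z) \<le> \<rho> ((T ^^ n) x) ((T ^^ n) y) + \<alpha> ^ n * \<rho> y z" for n
    using pm_triangle[OF \<rho>, of "(T ^^ n) x" "(T ^^ n) z" "(T ^^ n) y"] le[of n] by simp
  ultimately show ?case
    by (rule tendsto_zero_dominated[OF _ pm_nonneg[OF \<rho>]])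
qed

lemma orbit_tendsto_component:
  assumes "(\<lambda>n. (T ^^ n) x) \<longlonglongrightarrow> z" and "y \<in> component E x"
  shows "(\<lambda>n. (T ^^ n) y) \<longlonglongrightarrow> z"
  unfolding tendsto_iff_pseudometrics
proof
  fix \<rho> assume \<rho>: "\<rho> \<in> F"
  have "(\<lambda>n. \<rho> ((T ^^ n) x) ((T ^^ n) y) + \<rho> ((T ^^ n) x) z) \<longlonglongrightarrow> 0"
    using orbits_asymptotic[OF _ \<rho>, of x y] assms \<rho>
    by (intro tendsto_add_zero) (auto simp: component_eq_rtrancl tendsto_iff_pseudometrics)
  moreover have "\<rho> ((T ^^ n) y) z \<le> \<rho> ((T ^^ n) x) ((T ^^ n) y) + \<rho> ((T ^^ n) x) z" for n
    using pm_triangle[OF \<rho>, of "(T ^^ n) y" z "(T ^^ n) x"] pm_sym[OF \<rho>, of "(T ^^ n) y"] by simp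
  ultimately show "(\<lambda>n. \<rho> ((T ^^ n) y) z) \<longlonglongrightarrow> 0"
    by (rule tendsto_zero_dominated[OF _ pm_nonneg[OF \<rho>]])
qed

lemma Cauchy_orbit:
  assumes x: "x \<in> edge_start_set E T"
  shows "Cauchy (\<lambda>n. (T ^^ n) x)"
proof (rule Cauchy_pseudometrics)
  fix \<rho> assume \<rho>: "\<rho> \<in> F"
  have edge: "(x, T x) \<in> undirected E"
    using x by (auto simp: edge_start_set_def undirected_def)
  obtain \<alpha> where \<alpha>: "0 < \<alpha>" "\<alpha> < 1"
    and le: "\<And>n. \<rho> ((T ^^ n) x) ((T ^^ n) (T x)) \<le> \<alpha> ^ n * \<rho> x (T x)"
    using contraction_undirected edge \<rho> by metis
  \<comment> \<open>The sum of the geometric series with first term \<rho>(x, Tx) and ratio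
    \<open>\<alpha>\<close>.\<close>
  define c where "c = \<rho> x (T x) / (1 - \<alpha>)"
  have c: "0 \<le> c" "\<rho> x (T x) = (1 - \<alpha>) * c"
    using \<alpha> pm_nonneg[OF \<rho>] by (auto simp: c_def)
  \<comment> \<open>The bound \<open>\<alpha> ^ m * c\<close> is not inductive in \<open>k\<close>.
    With the tail subtracted the sum telescopes, as the next step contributes exactly
    \<open>(\<alpha> ^ (m + k) - \<alpha> ^ (m + Suc k)) * c\<close>.\<close>
  have "\<rho> ((T ^^ m) x) ((T ^^ (m + k)) x) \<le> (\<alpha> ^ m - \<alpha> ^ (m + k)) * c" for m k
  proof (induction k)
    case (Suc k)
    have "\<rho> ((T ^^ m) x) ((T ^^ (m + Suc k)) x)
        \<le> \<rho> ((T ^^ m) x) ((T ^^ (m + k)) x) + \<rho> ((T ^^ (m + k)) x) ((T ^^ (m + Suc k)) x)"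
      by (rule pm_triangle[OF \<rho>])
    also have "\<dots> \<le> (\<alpha> ^ m - \<alpha> ^ (m + k)) * c + \<alpha> ^ (m + k) * ((1 - \<alpha>) * c)"
      using le[of "m + k"] Suc c(2) by (intro add_mono) (simp_all add: funpow_swap1)
    finally show ?case by (simp add: algebra_simps)
  qed (simp add: pm_refl[OF \<rho>])
  moreover have "(\<alpha> ^ m - \<alpha> ^ (m + k)) * c \<le> \<alpha> ^ m * c" for m k
    using \<alpha> c(1) by (intro mult_right_mono) auto
  ultimately have "\<rho> ((T ^^ m) x) ((T ^^ (m + k)) x) \<le> \<alpha> ^ m * c" for m k
    by (rule order_trans)
  then have "\<rho> ((T ^^ m) x) ((T ^^ n) x) \<le> \<alpha> ^ m * c" if "m \<le> n" for m n
    using le_Suc_ex[OF that] by blast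
  moreover have "(\<lambda>m. \<alpha> ^ m * c) \<longlonglongrightarrow> 0"
    using \<alpha> by (intro tendsto_mult_left_zero LIMSEQ_realpow_zero) auto
  ultimately show "\<exists>C. C \<longlonglongrightarrow> 0 \<and> (\<forall>m n. m \<le> n \<longrightarrow> \<rho> ((T ^^ m) x) ((T ^^ n) x) \<le> C m)"
    by blast
qed

lemma orbit_tendsto_fixed_point:
  assumes "separated_uniformity TYPE('a)" "sequentially_complete TYPE('a)"
    and cont: "orbitally_G_continuous E T" and x: "x \<in> edge_start_set E T"
  shows "\<exists>z\<in>Fix T. \<forall>y\<in>component E x. (\<lambda>n. (T ^^ n) y) \<longlonglongrightarrow> z"
proof -
  obtain z where z: "(\<lambda>n. (T ^^ n) x) \<longlonglongrightarrow> z"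
    using assms(2) Cauchy_orbit[OF x] by (auto simp: sequentially_complete_def convergent_def)
  \<comment> \<open>Orbital continuity requires positive exponents, so it is applied with
    \<open>p = Suc\<close>, starting at Tx.\<close>
  then have shift: "(\<lambda>n. (T ^^ Suc n) x) \<longlonglongrightarrow> z"
    by (rule LIMSEQ_Suc)
  then have "(\<lambda>n. T ((T ^^ Suc n) x)) \<longlonglongrightarrow> T z"
    using cont[unfolded orbitally_G_continuous_def, rule_format, of Suc x z] orbit_edge[OF x]
    by blast
  \<comment> \<open>The same sequence is the orbit shifted by two; separation then identifies its
    limits \<open>T z\<close> and \<open>z\<close>.\<close>
  moreover have "(\<lambda>n. T ((T ^^ Suc n) x)) \<longlonglongrightarrow> z"
    using LIMSEQ_Suc[OF shift] by simp
  ultimately have "T z = z"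
    by (rule tendsto_unique_separated[OF assms(1) sequentially_bot])
  with z show ?thesis
    by (auto simp: Fix_def intro: orbit_tendsto_component)
qed

text \<open>The image of a path from x is a path from Tx, and the edge from x to Tx joins it to
  x.\<close>

lemma component_closed:
  assumes "x \<in> edge_start_set E T"
  shows "T ` component E x \<subseteq> component E x"
proof -
  have "(T x, T y) \<in> (undirected E)\<^sup>*" if "(x, y) \<in> (undirected E)\<^sup>*" for y
    using that by induction (use undirected_funpow[of _ _ 1] in \<open>auto intro: rtrancl_into_rtrancl\<close>)
  moreover have "(x, T x) \<in> undirected E"
    using assms by (simp add: edge_start_set_def undirected_def)
  ultimately show ?thesis
    by (auto simp: component_eq_rtrancl intro: converse_rtrancl_into_rtrancl)
qed

end

section \<open>Derivation of the five assertions\<close>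

lemma component_refl: "x \<in> component E x"
  by (simp add: component_eq_rtrancl)

lemma funpow_fixed: "T z = z \<Longrightarrow> (T ^^ n) z = z"
  by (induction n) auto

theorem theorem4:
  fixes F :: "('a::uniform_space \<Rightarrow> 'a \<Rightarrow> real) set"
    and E :: "('a \<times> 'a) set"
    and T :: "'a \<Rightarrow> 'a"
  assumes "separated_uniformity TYPE('a)"
    and "F \<noteq> {}"
    and "\<forall>\<rho>\<in>F. pseudometric \<rho>"
    and "generates_uniformity F"
    and "Id \<subseteq> E"
    and "sequentially_complete TYPE('a)"
    and "orbitally_G_continuous E T"
    and "Banach_G_contraction F E T"
  shows "(\<forall>x\<in>edge_start_set E T.
            (\<exists>!z. z \<in> Fix T \<and> (\<forall>y\<in>component E x. (\<lambda>n. (T ^^ n) y) \<longlonglongrightarrow> z)) \<and>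
            (\<forall>z. z \<in> Fix T \<and> (\<forall>y\<in>component E x. (\<lambda>n. (T ^^ n) y) \<longlonglongrightarrow> z) \<and> z \<in> component E x
                 \<longrightarrow> Picard_operator_on (component E x) T)) \<and>
         (edge_start_set E T \<noteq> {} \<and> weakly_connected E \<longrightarrow> Picard_operator_on UNIV T) \<and>
         (Fix T \<noteq> {} \<longleftrightarrow> edge_start_set E T \<noteq> {}) \<and>
         weakly_Picard_operator_on (\<Union>x\<in>edge_start_set E T. component E x) T \<and>
         (edge_start_set E T = UNIV \<longrightarrow> weakly_Picard_operator_on UNIV T)"
proof -
  interpret G_contraction F E T
    using assms by unfold_locales auto
  let ?S = "edge_start_set E T"
  let ?lim = "\<lambda>x z. z \<in> Fix T \<and> (\<forall>y\<in>component E x. (\<lambda>n. (T ^^ n) y) \<longlonglongrightarrow> z)"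
  note unique = tendsto_unique_separated[OF assms(1) sequentially_bot]
  have ex: "\<exists>z. ?lim x z" if "x \<in> ?S" for x
    using orbit_tendsto_fixed_point[OF assms(1,6,7) that] by blast
  \<comment> \<open>As x lies in its own component, any two candidates are limits of the orbit of
    x.\<close>
  have ex1: "\<exists>!z. ?lim x z" if "x \<in> ?S" for x
    using ex[OF that] unique component_refl[of x E] by blast
  have Picard: "Picard_operator_on (component E x) T"
    if "x \<in> ?S" "?lim x z" "z \<in> component E x" for x z
  proof -
    \<comment> \<open>A fixed point has a constant orbit, which must also converge to
      \<open>z\<close>.\<close>
    have "w = z" if "w \<in> component E x" "T w = w" for w
    proof (rule unique)
      show "(\<lambda>n. (T ^^ n) w) \<longlonglongrightarrow> w" using \<open>T w = w\<close> by (simp add: funpow_fixed)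
      show "(\<lambda>n. (T ^^ n) w) \<longlonglongrightarrow> z" using \<open>?lim x z\<close> \<open>w \<in> component E x\<close> by blast
    qed
    with that component_closed[of x] show ?thesis
      unfolding Picard_operator_on_def Fix_def by blast
  qed
  \<comment> \<open>Weak connectedness makes the component of any point of \<open>?S\<close> the
    whole space, so the limit belongs to it.\<close>
  have connected: "Picard_operator_on UNIV T" if "?S \<noteq> {} \<and> weakly_connected E"
    using Picard ex that by (fastforce simp: weakly_connected_def)
  \<comment> \<open>At a fixed point the required edge is a loop.\<close>
  have Fix_subset: "Fix T \<subseteq> ?S"
    using assms(5) by (auto simp: Fix_def edge_start_set_def)
  have weak: "weakly_Picard_operator_on (\<Union>x\<in>?S. component E x) T"
    unfolding weakly_Picard_operator_on_def using component_closed ex by blast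
  have "weakly_Picard_operator_on UNIV T" if "?S = UNIV"
  proof -
    have "(\<Union>x\<in>?S. component E x) = UNIV"
      using that by (auto intro: component_refl)
    then show ?thesis using weak by (rule subst)
  qed
  moreover have "Fix T \<noteq> {} \<longleftrightarrow> ?S \<noteq> {}"
    using Fix_subset ex by blast
  ultimately show ?thesis
    using weak
  proof (intro conjI ballI allI impI)
    fix x assume "x \<in> ?S"
    then show "\<exists>!z. ?lim x z" by (rule ex1)
  next
    fix x z assume "x \<in> ?S" "z \<in> Fix T \<and> (\<forall>y\<in>component E x. (\<lambda>n. (T ^^ n) y) \<longlonglongrightarrow> z) \<and> z \<in> component E x"
    then show "Picard_operator_on (component E x) T"
      using Picard[of x z] by simp
  next
    assume "?S \<noteq> {} \<and> weakly_connected E"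
    then show "Picard_operator_on UNIV T" by (rule connected)
  qed
qed

end
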